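(* Let $K$ be a field, let $\alpha\in K$ with $\alpha\neq0$, and let $L_9$ be the three-dimensional Leibniz algebra over $K$ with basis $\{e_1,e_2,e_3\}$ and nonzero products of basis elements $e_1e_3=e_2$, $e_2e_3=\alpha e_1$. If $K$ is infinite, then the polynomial $x_1(x_2x_3)$ generates the $T$-ideal of the identities of $L_9$. If $K$ is finite with $|K|=q$, then: (i) if $q$ is odd, the polynomials \[ x_1(x_2x_3),\qquad x_1x_2^{(q)}-\alpha^{\frac{q-1}{2}}x_1x_2 \] generate the $T$-ideal of the identities of $L_9$; (ii) if $q$ is even, the polynomials \[ x_1(x_2x_3),\qquad x_1x_2^{(2q-1)}-x_1x_2,\qquad x_1x_2^{(q)}x_3-x_1x_2x_3^{(q)} \] generate the $T$-ideal of the identities of $L_9$.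
   Context: A (right) Leibniz algebra over $K$ is a $K$-algebra satisfying $x(yz)=(xy)z-(xz)y$. Identities live in the free Leibniz algebra $\mathcal L\langle X\rangle$ over $K$ on $X=\{x_1,x_2,\dots\}$; the $T$-ideal of identities of $L$ is the set of polynomials vanishing under all substitutions of elements of $L$. A $T$-ideal is an ideal invariant under all endomorphisms of $\mathcal L\langle X\rangle$, and it is generated by $S$ if it is the smallest $T$-ideal containing $S$. Products without brackets are left-normed, and $x^{(m)}$ means $m$ consecutive occurrences of $x$ in a left-normed product (so $x_1x_2^{(q)}x_3$ is $x_1$ multiplied on the right $q$ times by $x_2$, then by $x_3$). Products of basis elements not listed are zero. *)

theory Defs
  imports Complex_Main "HOL-Library.Product_Plus"
begin

section \<open>Right Leibniz algebras\<close>

locale leibniz_algebra = vector_space scale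
  for scale :: "'k::field \<Rightarrow> 'a::ab_group_add \<Rightarrow> 'a" +
  fixes mul :: "'a \<Rightarrow> 'a \<Rightarrow> 'a"
  assumes mul_add_left: "mul (x + y) z = mul x z + mul y z"
    and mul_add_right: "mul x (y + z) = mul x y + mul x z"
    and mul_scale_left: "mul (scale c x) y = scale c (mul x y)"
    and mul_scale_right: "mul x (scale c y) = scale c (mul x y)"
    and leibniz: "mul x (mul y z) = mul (mul x y) z - mul (mul x z) y"

definition algebra_hom ::
  "('k::field \<Rightarrow> 'a::ab_group_add \<Rightarrow> 'a) \<Rightarrow> ('a \<Rightarrow> 'a \<Rightarrow> 'a) \<Rightarrow>
   ('k \<Rightarrow> 'b::ab_group_add \<Rightarrow> 'b) \<Rightarrow> ('b \<Rightarrow> 'b \<Rightarrow> 'b) \<Rightarrow> ('a \<Rightarrow> 'b) \<Rightarrow> bool" where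
  "algebra_hom s1 m1 s2 m2 f \<longleftrightarrow>
     Vector_Spaces.linear s1 s2 f \<and> (\<forall>x y. f (m1 x y) = m2 (f x) (f y))"


section \<open>The free Leibniz algebra on countably many generators\<close>

text \<open>
  The free algebra is built as the term algebra modulo the smallest congruence containing
  the defining laws of a Leibniz algebra. The lemma \<open>free_leibniz_universal\<close> below is
  its universal property.
\<close>

datatype 'k lterm =
    LGen nat
  | LZero
  | LAdd "'k lterm" "'k lterm"
  | LScale 'k "'k lterm"
  | LMul "'k lterm" "'k lterm"

inductive lcong :: "'k::field lterm \<Rightarrow> 'k lterm \<Rightarrow> bool" where
  lcong_refl: "lcong s s"
| lcong_sym: "lcong s t \<Longrightarrow> lcong t s"
| lcong_trans: "lcong s t \<Longrightarrow> lcong t u \<Longrightarrow> lcong s u"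
| lcong_add: "lcong s s' \<Longrightarrow> lcong t t' \<Longrightarrow> lcong (LAdd s t) (LAdd s' t')"
| lcong_scale: "lcong s s' \<Longrightarrow> lcong (LScale c s) (LScale c s')"
| lcong_mul: "lcong s s' \<Longrightarrow> lcong t t' \<Longrightarrow> lcong (LMul s t) (LMul s' t')"
| lcong_add_assoc: "lcong (LAdd (LAdd s t) u) (LAdd s (LAdd t u))"
| lcong_add_comm: "lcong (LAdd s t) (LAdd t s)"
| lcong_add_zero: "lcong (LAdd LZero s) s"
| lcong_add_inverse: "lcong (LAdd (LScale (- 1) s) s) LZero"
| lcong_scale_add_right: "lcong (LScale c (LAdd s t)) (LAdd (LScale c s) (LScale c t))"
| lcong_scale_add_left: "lcong (LScale (c + d) s) (LAdd (LScale c s) (LScale d s))"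
| lcong_scale_scale: "lcong (LScale c (LScale d s)) (LScale (c * d) s)"
| lcong_scale_one: "lcong (LScale 1 s) s"
| lcong_mul_add_left: "lcong (LMul (LAdd s t) u) (LAdd (LMul s u) (LMul t u))"
| lcong_mul_add_right: "lcong (LMul s (LAdd t u)) (LAdd (LMul s t) (LMul s u))"
| lcong_mul_scale_left: "lcong (LMul (LScale c s) t) (LScale c (LMul s t))"
| lcong_mul_scale_right: "lcong (LMul s (LScale c t)) (LScale c (LMul s t))"
| lcong_leibniz: "lcong (LMul s (LMul t u))
              (LAdd (LMul (LMul s t) u) (LScale (- 1) (LMul (LMul s u) t)))"

quotient_type (overloaded) 'k free_leibniz = "'k::field lterm" / lcong
proof (rule equivpI)
  show "reflp lcong" by (rule reflpI) (rule lcong_refl)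
  show "symp lcong" by (rule sympI) (rule lcong_sym)
  show "transp lcong" by (rule transpI) (rule lcong_trans)
qed

lift_definition gen :: "nat \<Rightarrow> 'k::field free_leibniz" is LGen .

lift_definition fscale :: "'k::field \<Rightarrow> 'k free_leibniz \<Rightarrow> 'k free_leibniz" is LScale
  by (rule lcong_scale)

instantiation free_leibniz :: (field) ab_group_add
begin

lift_definition zero_free_leibniz :: "'a free_leibniz" is LZero .

lift_definition plus_free_leibniz :: "'a free_leibniz \<Rightarrow> 'a free_leibniz \<Rightarrow> 'a free_leibniz"
  is LAdd by (rule lcong_add)

lift_definition uminus_free_leibniz :: "'a free_leibniz \<Rightarrow> 'a free_leibniz"
  is "LScale (- 1)" by (rule lcong_scale)

lift_definition minus_free_leibniz :: "'a free_leibniz \<Rightarrow> 'a free_leibniz \<Rightarrow> 'a free_leibniz"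
  is "\<lambda>s t. LAdd s (LScale (- 1) t)" by (intro lcong_add lcong_scale)

instance
proof
  fix a b c :: "'a free_leibniz"
  show "a + b + c = a + (b + c)" by transfer (rule lcong_add_assoc)
  show "a + b = b + a" by transfer (rule lcong_add_comm)
  show "0 + a = a" by transfer (rule lcong_add_zero)
  show "- a + a = 0" by transfer (rule lcong_add_inverse)
  show "a - b = a + - b" by transfer (rule lcong_refl)
qed

end

instantiation free_leibniz :: (field) times
begin

lift_definition times_free_leibniz :: "'a free_leibniz \<Rightarrow> 'a free_leibniz \<Rightarrow> 'a free_leibniz"
  is LMul by (rule lcong_mul)

instance ..

end

interpretation free_leibniz: leibniz_algebra fscale "(*)"
proof
  fix a b :: "'k::field" and x y z :: "'k free_leibniz"
  show "fscale a (x + y) = fscale a x + fscale a y" by transfer (rule lcong_scale_add_right)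
  show "fscale (a + b) x = fscale a x + fscale b x" by transfer (rule lcong_scale_add_left)
  show "fscale a (fscale b x) = fscale (a * b) x" by transfer (rule lcong_scale_scale)
  show "fscale 1 x = x" by transfer (rule lcong_scale_one)
  show "(x + y) * z = x * z + y * z" by transfer (rule lcong_mul_add_left)
  show "x * (y + z) = x * y + x * z" by transfer (rule lcong_mul_add_right)
  show "fscale a x * y = fscale a (x * y)" by transfer (rule lcong_mul_scale_left)
  show "x * fscale a y = fscale a (x * y)" by transfer (rule lcong_mul_scale_right)
  show "x * (y * z) = x * y * z - x * z * y" by transfer (rule lcong_leibniz)
qed

lemma free_leibniz_abs_cases:
  obtains t where "f = abs_free_leibniz t"
  by (metis Quotient3_abs_rep Quotient3_free_leibniz)

lemma free_leibniz_induct [case_names gen zero add scale mul]: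
  assumes "\<And>i. P (gen i)" and "P 0"
    and "\<And>f g. P f \<Longrightarrow> P g \<Longrightarrow> P (f + g)"
    and "\<And>c f. P f \<Longrightarrow> P (fscale c f)"
    and "\<And>f g. P f \<Longrightarrow> P g \<Longrightarrow> P (f * g)"
  shows "P (f :: 'k::field free_leibniz)"
proof -
  have "P (abs_free_leibniz t)" for t
    by (induction t)
      (use assms in \<open>auto simp: gen.abs_eq [symmetric] zero_free_leibniz.abs_eq [symmetric]
        plus_free_leibniz.abs_eq [symmetric] fscale.abs_eq [symmetric]
        times_free_leibniz.abs_eq [symmetric]\<close>)
  then show ?thesis
    by (cases f rule: free_leibniz_abs_cases) simp
qed

context leibniz_algebra
begin

primrec term_value :: "(nat \<Rightarrow> 'a) \<Rightarrow> 'k lterm \<Rightarrow> 'a" where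
  "term_value a (LGen i) = a i"
| "term_value a LZero = 0"
| "term_value a (LAdd s t) = term_value a s + term_value a t"
| "term_value a (LScale c s) = scale c (term_value a s)"
| "term_value a (LMul s t) = mul (term_value a s) (term_value a t)"

lemma term_value_cong: "lcong s t \<Longrightarrow> term_value a s = term_value a t"
proof (induction rule: lcong.induct)
  case (lcong_leibniz s t u)
  show ?case by (simp add: leibniz)
qed (simp_all add: algebra_simps mul_add_left mul_add_right mul_scale_left mul_scale_right)

theorem free_leibniz_universal:
  "\<exists>!\<phi>. algebra_hom fscale (*) scale mul \<phi> \<and> (\<forall>i. \<phi> (gen i) = a i)"
proof (rule ex_ex1I)
  define \<phi> where "\<phi> f = term_value a (rep_free_leibniz f)" for f
  have abs: "\<phi> (abs_free_leibniz t) = term_value a t" for t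
    unfolding \<phi>_def
    by (rule term_value_cong)
      (rule Quotient3_rep_abs [OF Quotient3_free_leibniz lcong_refl])
  have gen: "\<phi> (gen i) = a i" for i
    by (simp add: gen.abs_eq abs)
  have add: "\<phi> (f + g) = \<phi> f + \<phi> g" for f g
    by (cases f rule: free_leibniz_abs_cases, cases g rule: free_leibniz_abs_cases)
      (simp add: plus_free_leibniz.abs_eq abs)
  have scale: "\<phi> (fscale c f) = scale c (\<phi> f)" for c f
    by (cases f rule: free_leibniz_abs_cases) (simp add: fscale.abs_eq abs)
  have mul: "\<phi> (f * g) = mul (\<phi> f) (\<phi> g)" for f g
    by (cases f rule: free_leibniz_abs_cases, cases g rule: free_leibniz_abs_cases)
      (simp add: times_free_leibniz.abs_eq abs)
  have "Vector_Spaces.linear fscale scale \<phi>"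
    by unfold_locales (simp_all add: add scale algebra_simps)
  with mul gen show "\<exists>\<phi>. algebra_hom fscale (*) scale mul \<phi> \<and> (\<forall>i. \<phi> (gen i) = a i)"
    unfolding algebra_hom_def by blast
next
  fix \<phi> \<psi> :: "'k free_leibniz \<Rightarrow> 'a"
  assume \<phi>: "algebra_hom fscale (*) scale mul \<phi> \<and> (\<forall>i. \<phi> (gen i) = a i)"
    and \<psi>: "algebra_hom fscale (*) scale mul \<psi> \<and> (\<forall>i. \<psi> (gen i) = a i)"
  interpret p: Vector_Spaces.linear fscale scale \<phi>
    using \<phi> by (simp add: algebra_hom_def)
  interpret q: Vector_Spaces.linear fscale scale \<psi>
    using \<psi> by (simp add: algebra_hom_def)
  have "\<phi> f = \<psi> f" for f
    using \<phi> \<psi>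
    by (induction f rule: free_leibniz_induct)
      (simp_all add: algebra_hom_def p.add q.add p.scale q.scale)
  then show "\<phi> = \<psi>" ..
qed

end


section \<open>Identities and T-ideals\<close>

text \<open>\<open>substitution scale mul a f\<close> is the value \<open>f(a\<^sub>1, a\<^sub>2, \<dots>)\<close>, where the generator
  \<open>gen i\<close> is replaced by \<open>a i\<close>; it is well-defined by \<open>free_leibniz_universal\<close>.\<close>

definition substitution ::
  "('k::field \<Rightarrow> 'a::ab_group_add \<Rightarrow> 'a) \<Rightarrow> ('a \<Rightarrow> 'a \<Rightarrow> 'a) \<Rightarrow> (nat \<Rightarrow> 'a) \<Rightarrow>
   'k free_leibniz \<Rightarrow> 'a" where
  "substitution scale mul a =
     (THE \<phi>. algebra_hom fscale (*) scale mul \<phi> \<and> (\<forall>i. \<phi> (gen i) = a i))"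

lemma (in leibniz_algebra) substitution:
  shows algebra_hom_substitution: "algebra_hom fscale (*) scale mul (substitution scale mul a)"
    and substitution_gen: "substitution scale mul a (gen i) = a i"
  using theI' [OF free_leibniz_universal [of a]] unfolding substitution_def by blast+

definition identities ::
  "('k::field \<Rightarrow> 'a::ab_group_add \<Rightarrow> 'a) \<Rightarrow> ('a \<Rightarrow> 'a \<Rightarrow> 'a) \<Rightarrow> 'k free_leibniz set" where
  "identities scale mul = {f. \<forall>a. substitution scale mul a f = 0}"

definition T_ideal :: "'k::field free_leibniz set \<Rightarrow> bool" where
  "T_ideal I \<longleftrightarrow>
     module.subspace fscale I \<and>
     (\<forall>f\<in>I. \<forall>g. f * g \<in> I \<and> g * f \<in> I) \<and>
     (\<forall>\<phi>. algebra_hom fscale (*) fscale (*) \<phi> \<longrightarrow> \<phi> ` I \<subseteq> I)"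

definition generates_T_ideal :: "'k::field free_leibniz set \<Rightarrow> 'k free_leibniz set \<Rightarrow> bool" where
  "generates_T_ideal S I \<longleftrightarrow>
     T_ideal I \<and> S \<subseteq> I \<and> (\<forall>J. T_ideal J \<and> S \<subseteq> J \<longrightarrow> I \<subseteq> J)"

text \<open>The generators are numbered from 0, so \<open>x\<^sub>i\<close> is \<open>gen (i - 1)\<close>.\<close>

abbreviation X1 :: "'k::field free_leibniz" where "X1 \<equiv> gen 0"
abbreviation X2 :: "'k::field free_leibniz" where "X2 \<equiv> gen 1"
abbreviation X3 :: "'k::field free_leibniz" where "X3 \<equiv> gen 2"

text \<open>\<open>rmul_pow f g n\<close> is the left-normed product \<open>f g\<^sup>(\<^sup>n\<^sup>) = (\<dots>((f g) g)\<dots>) g\<close>.\<close>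

definition rmul_pow :: "'k::field free_leibniz \<Rightarrow> 'k free_leibniz \<Rightarrow> nat \<Rightarrow> 'k free_leibniz" where
  "rmul_pow f g n = ((\<lambda>h. h * g) ^^ n) f"


section \<open>The algebra \<open>L\<^sub>9\<close>\<close>

locale L9_algebra = leibniz_algebra scale mul
  for scale :: "'k::field \<Rightarrow> 'a::ab_group_add \<Rightarrow> 'a" and mul :: "'a \<Rightarrow> 'a \<Rightarrow> 'a" +
  fixes \<alpha> :: 'k and e1 e2 e3 :: 'a
  assumes basis: "distinct [e1, e2, e3]" "independent {e1, e2, e3}" "span {e1, e2, e3} = UNIV"
    and table:
      "mul e1 e1 = 0" "mul e1 e2 = 0" "mul e1 e3 = e2"
      "mul e2 e1 = 0" "mul e2 e2 = 0" "mul e2 e3 = scale \<alpha> e1"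
      "mul e3 e1 = 0" "mul e3 e2 = 0" "mul e3 e3 = 0"

text \<open>Such an algebra exists for every \<open>\<alpha>\<close>.\<close>

lemma L9_algebra_exists:
  "L9_algebra (\<lambda>c (x, y, z). (c * x, c * y, c * z))
     (\<lambda>(x, y, z) (x', y', z'). (\<alpha> * (y * z'), x * z', 0))
     (\<alpha>::'k::field) (1, 0, 0) (0, 1, 0) (0, 0, 1)"
proof -
  let ?s = "\<lambda>c (x, y, z). (c * x, c * y, c * z :: 'k)"
  let ?B = "{(1, 0, 0), (0, 1, 0), (0, 0, 1) :: 'k \<times> 'k \<times> 'k}"
  interpret leibniz_algebra ?s "\<lambda>(x, y, z) (x', y', z'). (\<alpha> * (y * z'), x * z', 0)"
    by unfold_locales (auto simp: algebra_simps zero_prod_def)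
  have "?s x (1, 0, 0) + ?s y (0, 1, 0) + ?s z (0, 0, 1) \<in> span ?B" for x y z
    by (intro span_add span_scale span_base; simp)
  then have "v \<in> span ?B" for v
    by (cases v) simp
  then have "span ?B = UNIV" by blast
  moreover have "independent ?B"
  proof (rule independent_if_scalars_zero)
    fix f v assume 0: "(\<Sum>v\<in>?B. ?s (f v) v) = 0" and v: "v \<in> ?B"
    from 0 show "f v = 0" using v by (auto simp: zero_prod_def)
  qed simp
  ultimately show ?thesis
    by unfold_locales (simp_all add: zero_prod_def)
qed

end

theory Submission
  imports Defs "HOL-Computational_Algebra.Polynomial"
begin

text \<open>
  Modulo \<open>x\<^sub>1(x\<^sub>2x\<^sub>3)\<close> the right multiplications commute, so every polynomial is a combination of
  words \<open>x\<^sub>i m\<close> where \<open>m\<close> is a commutative monomial in the right multiplications by generators.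
  In \<open>L\<^sub>9\<close> the right multiplication by \<open>a\<close> is \<open>c T\<close>, where \<open>c\<close> is the \<open>e\<^sub>3\<close>-coordinate of \<open>a\<close> and \<open>T\<close> is the
  right multiplication by \<open>e\<^sub>3\<close>; on the span of \<open>e\<^sub>1, e\<^sub>2\<close> one has \<open>T\<^sup>2 = \<alpha>\<close>, while \<open>T\<close> maps \<open>e\<^sub>1\<close> to \<open>e\<^sub>2\<close>.
  Hence the values of \<open>x\<^sub>i m\<close> depend only on \<open>i\<close>, on the function \<open>c \<mapsto> m(c)\<close> and on the parity of
  \<open>deg m\<close>. Functions \<open>m(c)\<close> are multiplicative in \<open>c\<close>, so distinct ones are linearly independent by
  Artin's lemma. It remains to see that two monomials with the same function and the same
  parity are proportional modulo the given polynomials. For infinite \<open>K\<close> they are equal. For odd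
  \<open>q\<close> both reduce to the unique monomial with all exponents below \<open>q\<close>. For even \<open>q\<close>
  the exchange relation collects all the excess in blocks \<open>t\<^sup>q\<^sup>-\<^sup>1\<close> of one variable \<open>t\<close> of \<open>m\<close>, two
  such blocks cancel, and the parity decides whether one remains, because \<open>q - 1\<close> is odd.
\<close>

section \<open>Powers and characters in fields\<close>

text \<open>Artin's elimination: subtracting \<open>\<chi> b y\<close> times the relation at
  \<open>x\<close> from the relation at \<open>op y x\<close> removes the term of \<open>b\<close>,
  and a \<open>y\<close> separating \<open>\<chi> a\<close> from \<open>\<chi> b\<close> keeps the
  coefficient of \<open>a\<close> alive.\<close>

lemma characters_independent:
  fixes \<chi> :: "'i \<Rightarrow> 'm \<Rightarrow> 'k::field"
  assumes "finite A" and "inj_on \<chi> A"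
    and "\<And>a x y. a \<in> A \<Longrightarrow> \<chi> a (op x y) = \<chi> a x * \<chi> a y"
    and "\<And>a. a \<in> A \<Longrightarrow> \<exists>x. \<chi> a x \<noteq> 0"
    and "\<And>x. (\<Sum>a\<in>A. k a * \<chi> a x) = 0"
    and "a \<in> A"
  shows "k a = 0"
  using assms
proof (induction A arbitrary: k a rule: finite_induct)
  case empty
  then show ?case by simp
next
  case (insert b A)
  have zero: "k a = 0" if a: "a \<in> A" for a
  proof -
    have "\<chi> a \<noteq> \<chi> b"
      using insert.hyps insert.prems(1) a by (auto simp: inj_on_def)
    then obtain y where y: "\<chi> a y \<noteq> \<chi> b y" by blast
    have "(\<Sum>a\<in>A. k a * (\<chi> a y - \<chi> b y) * \<chi> a x) = 0" for x
    proof -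
      have "k b * \<chi> b (op y x) + (\<Sum>a\<in>A. k a * \<chi> a (op y x)) = 0"
        using insert.prems(4)[of "op y x"] insert.hyps by simp
      moreover have "k b * \<chi> b x + (\<Sum>a\<in>A. k a * \<chi> a x) = 0"
        using insert.prems(4)[of x] insert.hyps by simp
      moreover have "\<chi> b (op y x) = \<chi> b y * \<chi> b x"
        using insert.prems(2) by simp
      moreover have "(\<Sum>a\<in>A. k a * \<chi> a (op y x)) = (\<Sum>a\<in>A. k a * (\<chi> a y * \<chi> a x))"
        using insert.prems(2) by (intro sum.cong) auto
      moreover have "(\<Sum>a\<in>A. k a * (\<chi> a y - \<chi> b y) * \<chi> a x)
          = (\<Sum>a\<in>A. k a * (\<chi> a y * \<chi> a x)) - \<chi> b y * (\<Sum>a\<in>A. k a * \<chi> a x)"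
        by (simp add: sum_distrib_left sum_subtractf algebra_simps)
      ultimately show ?thesis by algebra
    qed
    then have "k a * (\<chi> a y - \<chi> b y) = 0"
      using insert.IH[of "\<lambda>a. k a * (\<chi> a y - \<chi> b y)" a] insert.prems a
      by (auto simp: inj_on_def)
    with y show ?thesis by simp
  qed
  have "k b * \<chi> b x = 0" for x
    using insert.prems(4)[of x] insert.hyps zero by simp
  moreover obtain x where "\<chi> b x \<noteq> 0" using insert.prems(3) by blast
  ultimately have "k b = 0" by (metis mult_eq_0_iff)
  with zero show ?case using insert.prems(5) by blast
qed

text \<open>Multiplication by \<open>x\<close> permutes the nonzero elements, so it leaves their
  product unchanged.\<close>

lemma finite_field_power_card_minus_one:
  fixes x :: "'k::field"
  assumes "finite (UNIV :: 'k set)" and "x \<noteq> 0"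
  shows "x ^ (card (UNIV :: 'k set) - 1) = 1"
proof -
  have fin: "finite (UNIV - {0 :: 'k})" using assms(1) by simp
  have "bij_betw ((*) x) (UNIV - {0}) (UNIV - {0})"
    by (rule bij_betw_byWitness[where f' = "\<lambda>y. y / x"]) (use assms in auto)
  then have "(\<Prod>y\<in>UNIV - {0}. x * y) = \<Prod>(UNIV - {0})"
    by (rule prod.reindex_bij_betw)
  then have "x ^ card (UNIV - {0 :: 'k}) * \<Prod>(UNIV - {0}) = \<Prod>(UNIV - {0})"
    by (simp add: prod.distrib)
  moreover have "\<Prod>(UNIV - {0 :: 'k}) \<noteq> 0" using fin by simp
  ultimately show ?thesis using assms by (simp add: card_Diff_singleton)
qed

lemma finite_field_power_card:
  fixes x :: "'k::field"
  assumes "finite (UNIV :: 'k set)"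
  shows "x ^ card (UNIV :: 'k set) = x"
proof (cases "x = 0")
  case False
  have "card (UNIV :: 'k set) = Suc (card (UNIV :: 'k set) - 1)"
    using assms by (simp add: finite_UNIV_card_ge_0)
  then show ?thesis
    using finite_field_power_card_minus_one[OF assms False] by (metis mult.right_neutral power_Suc)
qed (use assms finite_UNIV_card_ge_0 in \<open>auto simp: power_0_left\<close>)

text \<open>Otherwise the difference of the two monomials is a nonzero polynomial vanishing on all
  of the field: impossible over an infinite field, and over a finite one it has more roots than its
  degree allows.\<close>

lemma power_functions_eq_imp_eq:
  fixes a b :: nat
  assumes eq: "\<And>x :: 'k::field. x ^ a = x ^ b"
    and small: "finite (UNIV :: 'k set) \<Longrightarrow> a < card (UNIV :: 'k set) \<and> b < card (UNIV :: 'k set)"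
  shows "a = b"
proof (rule ccontr)
  assume "a \<noteq> b"
  define p :: "'k poly" where "p = monom 1 a - monom 1 b"
  have "coeff p a \<noteq> 0" using \<open>a \<noteq> b\<close> by (simp add: p_def)
  then have "p \<noteq> 0" by auto
  have roots: "{x. poly p x = 0} = UNIV" using eq by (auto simp: p_def poly_monom)
  have fin: "finite (UNIV :: 'k set)"
    using poly_roots_finite[OF \<open>p \<noteq> 0\<close>] roots by simp
  have "degree p \<le> max a b"
    unfolding p_def by (intro degree_diff_le degree_monom_le[THEN order_trans]) auto
  then show False
    using card_poly_roots_bound[OF \<open>p \<noteq> 0\<close>] roots small[OF fin] by (simp add: max_def split: if_splits)
qed

lemma prod_mset_one_point:
  "(\<Prod>k\<in>#m. if k = j then x else 1) = (x :: 'k::comm_monoid_mult) ^ count m j"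
  by (induction m) (auto simp: mult.commute)

text \<open>Points equal to 1 outside one coordinate isolate a single exponent, which reduces the
  claim to one variable.\<close>

lemma reduced_multiset_eqI:
  fixes m m' :: "nat multiset"
  assumes eq: "\<And>c :: nat \<Rightarrow> 'k::field. (\<Prod>j\<in>#m. c j) = (\<Prod>j\<in>#m'. c j)"
    and small: "\<And>j. finite (UNIV :: 'k set) \<Longrightarrow>
      count m j < card (UNIV :: 'k set) \<and> count m' j < card (UNIV :: 'k set)"
  shows "m = m'"
proof (rule multiset_eqI)
  fix j
  show "count m j = count m' j"
  proof (rule power_functions_eq_imp_eq)
    show "x ^ count m j = x ^ count m' j" for x :: 'k
      using eq[of "\<lambda>k. if k = j then x else 1"] by (simp add: prod_mset_one_point)
  qed (use small in blast)
qed


section \<open>Commutative monomials modulo a T-ideal\<close>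

context leibniz_algebra
begin

lemma mul_zero_left [simp]: "mul 0 x = 0" and mul_zero_right [simp]: "mul x 0 = 0"
  using mul_add_left[of 0 0 x] mul_add_right[of x 0 0] by simp_all

end

text \<open>Words are lists here, because right multiplications commute only modulo a suitable
  T-ideal.\<close>

definition rmul :: "'k::field free_leibniz \<Rightarrow> nat list \<Rightarrow> 'k free_leibniz" where
  "rmul h l = foldl (\<lambda>h j. h * gen j) h l"

lemma rmul_simps [simp]:
  "rmul h [] = h" "rmul h (j # l) = rmul (h * gen j) l" "rmul h (l @ l') = rmul (rmul h l) l'"
  by (simp_all add: rmul_def)

lemma rmul_replicate: "rmul h (replicate n j) = rmul_pow h (gen j) n"
  by (induction n arbitrary: h) (simp_all add: rmul_pow_def funpow_Suc_right del: funpow.simps)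

lemma free_mul_diff_left: "(x - y) * z = x * z - y * (z :: 'k::field free_leibniz)"
  by (metis add_diff_cancel_right' diff_add_cancel free_leibniz.mul_add_left)

lemma rmul_diff: "rmul (h - h') l = rmul h l - rmul h' l"
  by (induction l arbitrary: h h') (simp_all add: free_mul_diff_left)

lemma rmul_scale: "rmul (fscale c h) l = fscale c (rmul h l)"
  by (induction l arbitrary: h) (simp_all add: free_leibniz.mul_scale_left)

text \<open>Minimality of the generated T-ideal speaks about every T-ideal containing the
  generators, so the reductions are done for an arbitrary one.\<close>

locale left_normed_T_ideal =
  fixes J :: "'k::field free_leibniz set"
  assumes T: "T_ideal J" and X123: "X1 * (X2 * X3) \<in> J"
begin

lemma subspace: "free_leibniz.subspace J"
  using T by (simp add: T_ideal_def)

lemma mult_right: "f \<in> J \<Longrightarrow> f * g \<in> J" and mult_left: "f \<in> J \<Longrightarrow> g * f \<in> J"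
  using T by (simp_all add: T_ideal_def)

lemma subst_mem:
  assumes "f \<in> J"
  shows "substitution fscale (*) a f \<in> J"
  using T assms free_leibniz.algebra_hom_substitution[of a] unfolding T_ideal_def by blast

lemma mult_mult_mem: "x * (y * z) \<in> J"
proof -
  let ?a = "\<lambda>i :: nat. if i = 0 then x else if i = 1 then y else z"
  have "substitution fscale (*) ?a (u * v)
      = substitution fscale (*) ?a u * substitution fscale (*) ?a v" for u v
    using free_leibniz.algebra_hom_substitution[of ?a] unfolding algebra_hom_def by blast
  then have "substitution fscale (*) ?a (X1 * (X2 * X3)) = x * (y * z)"
    by (simp add: free_leibniz.substitution_gen)
  with subst_mem[OF X123, of ?a] show ?thesis by simp
qed

text \<open>The Leibniz law turns \<open>x * (y * z)\<close> into exactly this difference.\<close>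

lemma swap_mem: "x * y * z - x * z * y \<in> J"
  using mult_mult_mem[of x y z] by (simp add: free_leibniz.leibniz)

lemmas add_mem = free_leibniz.subspace_add[OF subspace]
lemmas diff_mem = free_leibniz.subspace_diff[OF subspace]
lemmas scale_mem = free_leibniz.subspace_scale[OF subspace]
lemmas zero_mem = free_leibniz.subspace_0[OF subspace]

lemma diff_mem_trans: "x - y \<in> J \<Longrightarrow> y - z \<in> J \<Longrightarrow> x - z \<in> J"
  using add_mem[of "x - y" "y - z"] by simp

lemma rmul_mem: "h \<in> J \<Longrightarrow> rmul h l \<in> J"
  by (induction l arbitrary: h) (simp_all add: mult_right)

lemma rmul_Cons_middle: "rmul h (l @ x # l') - rmul h (x # l @ l') \<in> J"
proof (induction l arbitrary: h)
  case (Cons y l)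
  have "rmul (h * gen y) (l @ x # l') - rmul (h * gen y) (x # l @ l') \<in> J"
    by (rule Cons.IH)
  moreover have "rmul (h * gen y * gen x) (l @ l') - rmul (h * gen x * gen y) (l @ l') \<in> J"
    unfolding rmul_diff[symmetric] by (intro rmul_mem swap_mem)
  ultimately show ?case by (auto intro: diff_mem_trans)
qed (simp add: zero_mem)

lemma rmul_perm: "mset l = mset l' \<Longrightarrow> rmul h l - rmul h l' \<in> J"
proof (induction l arbitrary: l' h)
  case (Cons x l)
  then obtain u v where l': "l' = u @ x # v"
    by (metis list.set_intros(1) mset_eq_setD split_list)
  with Cons.prems have "mset l = mset (u @ v)" by simp
  then have "rmul (h * gen x) l - rmul (h * gen x) (u @ v) \<in> J"
    by (rule Cons.IH)
  moreover have "rmul h (x # u @ v) - rmul h (u @ x # v) \<in> J"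
    using diff_mem[OF zero_mem rmul_Cons_middle[of h u x v]] by simp
  ultimately show ?case unfolding l' by (auto intro: diff_mem_trans)
qed (simp add: zero_mem)

text \<open>
  Monomials are multisets of generator indices. Since every left factor \<open>h\<close> is allowed, \<open>sim\<close> is
  compatible with multiplication of monomials.
\<close>

definition sim :: "nat multiset \<Rightarrow> nat multiset \<Rightarrow> bool" where
  "sim m m' \<longleftrightarrow> (\<exists>c. c \<noteq> 0 \<and> (\<forall>h l l'. mset l = m \<longrightarrow> mset l' = m' \<longrightarrow>
     rmul h l - fscale c (rmul h l') \<in> J))"

text \<open>By \<open>rmul_perm\<close> it is enough to compare one arrangement of each
  monomial.\<close>

lemma simI:
  assumes "c \<noteq> 0" and "\<And>h. rmul h l - fscale c (rmul h l') \<in> J"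
  shows "sim (mset l) (mset l')"
  unfolding sim_def
proof (intro exI[of _ c] conjI allI impI)
  fix h k k' assume k: "mset k = mset l" and k': "mset k' = mset l'"
  have "rmul h k - rmul h l \<in> J" using k by (rule rmul_perm)
  moreover have "fscale c (rmul h l') - fscale c (rmul h k') \<in> J"
    using scale_mem[OF rmul_perm[of l' k' h], of c] k'
    by (simp add: free_leibniz.scale_right_diff_distrib)
  ultimately show "rmul h k - fscale c (rmul h k') \<in> J"
    using assms(2)[of h] diff_mem_trans by blast
qed fact

lemma sim_refl: "sim m m"
proof -
  obtain l where "mset l = m" using ex_mset by blast
  then show ?thesis using simI[of 1 l l] by (simp add: zero_mem)
qed

text \<open>The scalar in \<open>sim\<close> is nonzero, so the relation can be multiplied by
  \<open>- inverse c\<close>.\<close>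

lemma sim_sym: assumes "sim m m'" shows "sim m' m"
proof -
  obtain l l' where l: "mset l = m" "mset l' = m'"
    using ex_mset[of m] ex_mset[of m'] by blast
  obtain c where c: "c \<noteq> 0" "\<And>h. rmul h l - fscale c (rmul h l') \<in> J"
    using assms l unfolding sim_def by blast
  have "rmul h l' - fscale (inverse c) (rmul h l) \<in> J" for h
    using scale_mem[OF c(2)[of h], of "- inverse c"] c(1)
    by (simp add: free_leibniz.scale_right_diff_distrib)
  then show ?thesis using simI[of "inverse c" l' l] c(1) l by simp
qed

lemma sim_trans [trans]: assumes "sim m m'" "sim m' m''" shows "sim m m''"
proof -
  obtain l l' l'' where l: "mset l = m" "mset l' = m'" "mset l'' = m''"
    using ex_mset[of m] ex_mset[of m'] ex_mset[of m''] by blast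
  obtain c where c: "c \<noteq> 0" "\<And>h. rmul h l - fscale c (rmul h l') \<in> J"
    using assms(1) l unfolding sim_def by blast
  obtain d where d: "d \<noteq> 0" "\<And>h. rmul h l' - fscale d (rmul h l'') \<in> J"
    using assms(2) l unfolding sim_def by blast
  have "rmul h l - fscale (c * d) (rmul h l'') \<in> J" for h
    using diff_mem_trans[OF c(2)[of h]] scale_mem[OF d(2)[of h], of c]
    by (simp add: free_leibniz.scale_right_diff_distrib)
  then show ?thesis using simI[of "c * d" l l''] c(1) d(1) l by simp
qed

lemma sim_add: assumes "sim m m'" shows "sim (m + n) (m' + n)"
proof -
  obtain l l' where l: "mset l = m" "mset l' = m'"
    using ex_mset[of m] ex_mset[of m'] by blast
  obtain k where k: "mset k = n" using ex_mset by blast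
  obtain c where c: "c \<noteq> 0" "\<And>h. rmul h l - fscale c (rmul h l') \<in> J"
    using assms l unfolding sim_def by blast
  have "rmul h (l @ k) - fscale c (rmul h (l' @ k)) \<in> J" for h
    using rmul_mem[OF c(2)[of h], of k] by (simp add: rmul_diff rmul_scale)
  then show ?thesis using simI[of c "l @ k" "l' @ k"] c(1) l k by simp
qed

text \<open>It suffices that this span is closed under products. A right factor that is a generator
  extends the word; a longer right factor is itself a product and sends everything into
  \<open>J\<close>.\<close>

lemma span_words: "f \<in> free_leibniz.span (range (\<lambda>(i, l). rmul (gen i) l) \<union> J)"
proof -
  define W where "W = range (\<lambda>(i, l). rmul (gen i) l) \<union> J"
  let ?S = "free_leibniz.span W"
  have J: "x \<in> J \<Longrightarrow> x \<in> ?S" for x by (simp add: W_def free_leibniz.span_base)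
  have word: "rmul (gen i) l \<in> ?S" for i l
    by (rule free_leibniz.span_base) (auto simp: W_def)
  have W_cases: "x \<in> J \<or> (\<exists>i l. x = rmul (gen i) l)" if "x \<in> W" for x
    using that by (auto simp: W_def)
  have gen: "x * gen j \<in> ?S" if "x \<in> ?S" for x j
    using that
  proof (induction rule: free_leibniz.span_induct_alt)
    case base
    then show ?case by (simp add: free_leibniz.span_zero)
  next
    case (step c x y)
    have "x * gen j \<in> ?S"
      using W_cases[OF step(1)]
    proof
      assume "\<exists>i l. x = rmul (gen i) l"
      then obtain i l where "x * gen j = rmul (gen i) (l @ [j])" by auto
      then show ?thesis by (metis word)
    qed (intro J mult_right)
    then show ?case
      unfolding free_leibniz.mul_add_left free_leibniz.mul_scale_left
      by (intro free_leibniz.span_add free_leibniz.span_scale step)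
  qed
  have mult: "x * y \<in> ?S" if "y \<in> ?S" "x \<in> ?S" for x y
    using that(1)
  proof (induction rule: free_leibniz.span_induct_alt)
    case base
    then show ?case by (simp add: free_leibniz.span_zero)
  next
    case (step c y z)
    have "x * y \<in> ?S"
      using W_cases[OF step(1)]
    proof
      assume "\<exists>i l. y = rmul (gen i) l"
      then obtain i l where y: "y = rmul (gen i) l" by blast
      show ?thesis
      proof (cases l rule: rev_cases)
        case Nil
        then show ?thesis using y gen[OF that(2)] by simp
      next
        case (snoc l' j)
        then show ?thesis using y J[OF mult_mult_mem] by simp
      qed
    qed (intro J mult_left)
    then show ?case
      unfolding free_leibniz.mul_add_right free_leibniz.mul_scale_right
      by (intro free_leibniz.span_add free_leibniz.span_scale step)
  qed
  have "f \<in> ?S"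
  proof (induction f rule: free_leibniz_induct)
    case (gen i)
    show ?case using word[of i "[]"] by simp
  qed (simp_all add: mult free_leibniz.span_zero free_leibniz.span_add free_leibniz.span_scale)
  then show ?thesis unfolding W_def .
qed

text \<open>A word is proportional modulo \<open>J\<close> to the word of its representative;
  sorting merely fixes one arrangement.\<close>

lemma span_representatives:
  assumes s: "\<And>m. sim m (s m)"
  shows "f \<in> free_leibniz.span
    ((\<lambda>(i, m). rmul (gen i) (sorted_list_of_multiset m)) ` (UNIV \<times> range s) \<union> J)"
    (is "f \<in> free_leibniz.span ?B")
proof -
  have "rmul (gen i) l \<in> free_leibniz.span ?B" for i l
  proof -
    let ?r = "rmul (gen i) (sorted_list_of_multiset (s (mset l)))"
    obtain c where "rmul (gen i) l - fscale c ?r \<in> J"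
      using s[of "mset l"] unfolding sim_def by (metis mset_sorted_list_of_multiset)
    then have "rmul (gen i) l - fscale c ?r \<in> free_leibniz.span ?B"
      by (simp add: free_leibniz.span_base)
    moreover have "?r \<in> free_leibniz.span ?B"
      by (rule free_leibniz.span_base) auto
    ultimately show ?thesis
      by (metis diff_add_cancel free_leibniz.span_add free_leibniz.span_scale)
  qed
  then have "range (\<lambda>(i, l). rmul (gen i) l) \<union> J \<subseteq> free_leibniz.span ?B"
    by (auto intro: free_leibniz.span_base)
  then have "free_leibniz.span (range (\<lambda>(i, l). rmul (gen i) l) \<union> J) \<subseteq> free_leibniz.span ?B"
    by (metis free_leibniz.span_mono free_leibniz.span_span)
  then show ?thesis using span_words by blast
qed

end

lemma hom_rmul_pow:
  assumes "algebra_hom fscale (*) fscale (*) \<phi>"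
  shows "\<phi> (rmul_pow f g n) = rmul_pow (\<phi> f) (\<phi> g) n"
  using assms by (induction n) (simp_all add: rmul_pow_def algebra_hom_def)

section \<open>Reduction of exponents over a finite field\<close>

lemma reduced_or_split:
  fixes m :: "nat multiset"
  assumes "\<not> (\<forall>j. count m j < q)"
  obtains j n where "m = n + replicate_mset q j"
proof -
  obtain j where "q \<le> count m j" using assms not_less by blast
  then have "replicate_mset q j \<subseteq># m" by (simp add: count_le_replicate_mset_subset_eq)
  then have "m = (m - replicate_mset q j) + replicate_mset q j" by simp
  then show ?thesis by (rule that)
qed

lemma replicate_mset_add: "replicate_mset (a + b) x = replicate_mset a x + replicate_mset b x"
  by (induction a) simp_all

context left_normed_T_ideal
begin

text \<open>Replacing \<open>q\<close> copies of a variable by one shortens the monomial and, by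
  Fermat, keeps its function. This is the reduction for odd \<open>q\<close>.\<close>

lemma sim_reduced:
  assumes q: "2 \<le> q" and Fermat: "\<And>x :: 'k. x ^ q = x"
    and power: "\<And>j. sim (replicate_mset q j) {#j#}"
  shows "\<exists>r. (\<forall>j. count r j < q) \<and> sim m r \<and>
    (\<forall>c :: nat \<Rightarrow> 'k. (\<Prod>j\<in>#m. c j) = (\<Prod>j\<in>#r. c j))"
proof (induction m rule: measure_induct_rule[where f = size])
  case (less m)
  show ?case
  proof (cases "\<forall>j. count m j < q")
    case True
    then show ?thesis using sim_refl by blast
  next
    case False
    then obtain j n where m: "m = n + replicate_mset q j" by (rule reduced_or_split)
    then have "size (n + {#j#}) < size m" using q by simp
    from less[OF this] obtain r where r: "\<forall>j. count r j < q" "sim (n + {#j#}) r"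
      "\<forall>c :: nat \<Rightarrow> 'k. (\<Prod>j\<in>#n + {#j#}. c j) = (\<Prod>j\<in>#r. c j)" by blast
    have "sim m (n + {#j#})"
      using sim_add[OF power[of j], of n] unfolding m by (simp add: add.commute)
    moreover have "(\<Prod>j\<in>#m. c j) = (\<Prod>j\<in>#n + {#j#}. c j)" for c :: "nat \<Rightarrow> 'k"
      unfolding m by (simp add: Fermat)
    ultimately show ?thesis using r sim_trans by metis
  qed
qed

text \<open>The excess \<open>q - 1\<close> of the variable \<open>j\<close> is handed over to a
  variable \<open>i\<close> that is already present.\<close>

lemma sim_exchange:
  assumes exchange: "\<And>i j. sim (replicate_mset q i + {#j#}) (replicate_mset q j + {#i#})"
    and q: "2 \<le> q" and i: "i \<in># n + {#j#}"
  shows "sim (n + replicate_mset q j) (n + {#j#} + replicate_mset (q - 1) i)"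
proof (cases "i = j")
  case True
  have "replicate_mset q j = {#j#} + replicate_mset (q - 1) j"
    using replicate_mset_add[of 1 "q - 1" j] q by simp
  then show ?thesis using True sim_refl by (simp add: add.assoc)
next
  case False
  then have "i \<in># n" using i by simp
  then obtain n' where n: "n = n' + {#i#}" by (metis add_mset_add_single insert_DiffM2 add.commute)
  have "replicate_mset q i = {#i#} + replicate_mset (q - 1) i"
    using replicate_mset_add[of 1 "q - 1" i] q by simp
  then show ?thesis
    using sim_add[OF exchange[of j i], of n'] unfolding n by (simp add: ac_simps add_mset_commute)
qed

text \<open>All excess is collected on one fixed variable \<open>i\<close>. Keeping \<open>i\<close>
  in \<open>r\<close> lets blocks cancel later, and the size equation makes the parity of the number
  of blocks readable from the degree when \<open>q\<close> is even.\<close>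

lemma sim_reduced_shifted:
  assumes q: "2 \<le> q" and Fermat: "\<And>x :: 'k. x ^ q = x"
    and exchange: "\<And>i j. sim (replicate_mset q i + {#j#}) (replicate_mset q j + {#i#})"
    and "i \<in># m"
  shows "\<exists>r n. i \<in># r \<and> (\<forall>j. count r j < q) \<and> sim m (r + replicate_mset (n * (q - 1)) i) \<and>
    (\<forall>c :: nat \<Rightarrow> 'k. (\<Prod>j\<in>#m. c j) = (\<Prod>j\<in>#r. c j)) \<and>
    size m = size r + n * (q - 1)"
  using \<open>i \<in># m\<close>
proof (induction m rule: measure_induct_rule[where f = size])
  case (less m)
  show ?case
  proof (cases "\<forall>j. count m j < q")
    case True
    then show ?thesis using sim_refl[of m] less.prems by (intro exI[of _ m] exI[of _ 0]) simp
  next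
    case False
    then obtain j n where m: "m = n + replicate_mset q j" by (rule reduced_or_split)
    then have "size (n + {#j#}) < size m" using q by simp
    moreover have i: "i \<in># n + {#j#}" using less.prems m by (auto split: if_splits)
    ultimately obtain r k where r: "i \<in># r" "\<forall>j. count r j < q"
      "sim (n + {#j#}) (r + replicate_mset (k * (q - 1)) i)"
      "\<forall>c :: nat \<Rightarrow> 'k. (\<Prod>j\<in>#n + {#j#}. c j) = (\<Prod>j\<in>#r. c j)"
      "size (n + {#j#}) = size r + k * (q - 1)" using less.IH by blast
    have "sim m (n + {#j#} + replicate_mset (q - 1) i)"
      unfolding m by (rule sim_exchange[OF exchange q i])
    also have "sim \<dots> (r + replicate_mset (k * (q - 1)) i + replicate_mset (q - 1) i)"
      by (rule sim_add[OF r(3)])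
    also have "\<dots> = r + replicate_mset (Suc k * (q - 1)) i"
      by (simp add: replicate_mset_add ac_simps)
    finally have "sim m (r + replicate_mset (Suc k * (q - 1)) i)" .
    moreover have "(\<Prod>j\<in>#m. c j) = (\<Prod>j\<in>#r. c j)" for c :: "nat \<Rightarrow> 'k"
      using r(4)[rule_format, of c] unfolding m by (simp add: Fermat mult.commute)
    moreover have "size m = size r + Suc k * (q - 1)"
      using r(5) q unfolding m by simp
    ultimately show ?thesis using r by blast
  qed
qed

text \<open>One copy of \<open>i\<close> from \<open>r\<close> together with two blocks has exponent
  \<open>2 * q - 1\<close>, which \<open>power\<close> reduces to 1.\<close>

lemma sim_shift_mod_2:
  assumes q: "2 \<le> q" and power: "\<And>j. sim (replicate_mset (2 * q - 1) j) {#j#}"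
    and "i \<in># r"
  shows "sim (r + replicate_mset (n * (q - 1)) i) (r + replicate_mset (n mod 2 * (q - 1)) i)"
proof (induction n rule: less_induct)
  case (less n)
  show ?case
  proof (cases "n < 2")
    case True
    then show ?thesis by (simp add: sim_refl)
  next
    case False
    define k where "k = n - 2"
    have n: "n = k + 2" using False by (simp add: k_def)
    obtain r' where r: "r = r' + {#i#}"
      using \<open>i \<in># r\<close> by (metis add_mset_add_single insert_DiffM2 add.commute)
    have "2 * q - 1 = 1 + 2 * (q - 1)" using q by simp
    then have rep: "replicate_mset (2 * q - 1) i = {#i#} + replicate_mset (2 * (q - 1)) i"
      by (metis replicate_mset_add replicate_mset_0 replicate_mset_Suc One_nat_def)
    have "n * (q - 1) = 2 * (q - 1) + k * (q - 1)"
      unfolding n by (simp only: add_mult_distrib add.commute)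
    then have "r + replicate_mset (n * (q - 1)) i
        = replicate_mset (2 * q - 1) i + (r' + replicate_mset (k * (q - 1)) i)"
      unfolding rep r by (simp only: replicate_mset_add ac_simps)
    also have "sim \<dots> ({#i#} + (r' + replicate_mset (k * (q - 1)) i))"
      by (rule sim_add[OF power])
    also have "\<dots> = r + replicate_mset (k * (q - 1)) i"
      unfolding r by (simp only: ac_simps)
    also have "sim \<dots> (r + replicate_mset (k mod 2 * (q - 1)) i)"
      by (rule less.IH) (simp add: n)
    also have "k mod 2 = n mod 2" by (simp add: n)
    finally show ?thesis .
  qed
qed

lemma sim_if_same_function_and_parity:
  assumes q: "even q" "q = card (UNIV :: 'k set)" "2 \<le> q" and Fermat: "\<And>x :: 'k. x ^ q = x"
    and exchange: "\<And>i j. sim (replicate_mset q i + {#j#}) (replicate_mset q j + {#i#})"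
    and power: "\<And>j. sim (replicate_mset (2 * q - 1) j) {#j#}"
    and eq: "\<And>c :: nat \<Rightarrow> 'k. (\<Prod>j\<in>#m. c j) = (\<Prod>j\<in>#m'. c j)"
    and parity: "even (size m) \<longleftrightarrow> even (size m')"
  shows "sim m m'"
proof (cases "m = {#}")
  case True
  have "m' = {#}"
    \<comment> \<open>At the zero point the empty product is 1 and every other product is 0.\<close>
    using eq[of "\<lambda>_. 0"] unfolding True by (cases m') auto
  with True show ?thesis by (simp add: sim_refl)
next
  case False
  then obtain i where i: "i \<in># m" by blast
  have i': "i \<in># m'"
    \<comment> \<open>At this point a product vanishes exactly when \<open>i\<close> occurs, so both
      monomials can collect their excess on the same variable.\<close>
    using eq[of "\<lambda>j. if j = i then 0 else 1"] i
    by (auto simp: prod_mset_one_point power_0_left count_eq_zero_iff split: if_splits)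
  obtain r n where r: "i \<in># r" "\<forall>j. count r j < q" "sim m (r + replicate_mset (n * (q - 1)) i)"
    "\<forall>c :: nat \<Rightarrow> 'k. (\<Prod>j\<in>#m. c j) = (\<Prod>j\<in>#r. c j)" "size m = size r + n * (q - 1)"
    using sim_reduced_shifted[OF q(3) Fermat exchange i] by blast
  obtain r' n' where r': "i \<in># r'" "\<forall>j. count r' j < q"
    "sim m' (r' + replicate_mset (n' * (q - 1)) i)"
    "\<forall>c :: nat \<Rightarrow> 'k. (\<Prod>j\<in>#m'. c j) = (\<Prod>j\<in>#r'. c j)" "size m' = size r' + n' * (q - 1)"
    using sim_reduced_shifted[OF q(3) Fermat exchange i'] by blast
  have "r = r'"
  proof (rule reduced_multiset_eqI)
    show "(\<Prod>j\<in>#r. c j) = (\<Prod>j\<in>#r'. c j)" for c :: "nat \<Rightarrow> 'k"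
      using eq[of c] r(4) r'(4) by simp
  qed (use r(2) r'(2) q(2) in auto)
  \<comment> \<open>The reduced parts have equal size, so the parities of the degrees compare the
    blocks alone.\<close>
  then have "even (n * (q - 1)) \<longleftrightarrow> even (n' * (q - 1))"
    using parity unfolding r(5) r'(5) \<open>r = r'\<close> even_add by blast
  then have "n mod 2 = n' mod 2" using q(1,3) by (auto simp: mod2_eq_if)
  then show ?thesis
    using sim_trans[OF r(3) sim_shift_mod_2[OF q(3) power r(1)]]
      sim_trans[OF r'(3) sim_shift_mod_2[OF q(3) power r'(1)]] \<open>r = r'\<close> sim_sym sim_trans
    by metis
qed

end


section \<open>Evaluation in the algebra\<close>

context leibniz_algebra
begin

lemma subst_add: "substitution scale mul a (f + g) =
      substitution scale mul a f + substitution scale mul a g"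
  and subst_scale: "substitution scale mul a (fscale c f) = scale c (substitution scale mul a f)"
  and subst_diff: "substitution scale mul a (f - g) =
      substitution scale mul a f - substitution scale mul a g"
  and subst_zero: "substitution scale mul a 0 = 0"
  and subst_mul: "substitution scale mul a (f * g) =
      mul (substitution scale mul a f) (substitution scale mul a g)"
proof -
  interpret s: Vector_Spaces.linear fscale scale "substitution scale mul a"
    using algebra_hom_substitution[of a] by (simp add: algebra_hom_def)
  show "substitution scale mul a (f + g) = substitution scale mul a f + substitution scale mul a g"
    and "substitution scale mul a (fscale c f) = scale c (substitution scale mul a f)"
    and "substitution scale mul a (f - g) = substitution scale mul a f - substitution scale mul a g"
    and "substitution scale mul a 0 = 0"
    by (fact s.add s.scale s.diff s.zero)+
  show "substitution scale mul a (f * g) =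
      mul (substitution scale mul a f) (substitution scale mul a g)"
    using algebra_hom_substitution[of a] by (simp add: algebra_hom_def)
qed

lemmas subst_simps = subst_add subst_scale subst_diff subst_zero subst_mul substitution_gen

lemma subst_sum:
  "substitution scale mul a (\<Sum>x\<in>A. f x) = (\<Sum>x\<in>A. substitution scale mul a (f x))"
  by (induction A rule: infinite_finite_induct) (simp_all add: subst_simps)

text \<open>Both sides are linear and multiplicative in \<open>f\<close> and agree on generators.
  This yields the invariance of the identities under endomorphisms.\<close>

lemma subst_compose:
  assumes "algebra_hom fscale (*) fscale (*) \<psi>"
  shows "substitution scale mul a (\<psi> f) =
    substitution scale mul (\<lambda>i. substitution scale mul a (\<psi> (gen i))) f"
proof -
  interpret \<psi>: Vector_Spaces.linear fscale fscale \<psi>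
    using assms by (simp add: algebra_hom_def)
  have "\<psi> (f * g) = \<psi> f * \<psi> g" for f g using assms by (simp add: algebra_hom_def)
  then show ?thesis
    by (induction f rule: free_leibniz_induct)
      (simp_all add: subst_simps \<psi>.add \<psi>.scale \<psi>.zero)
qed

lemma T_ideal_identities: "T_ideal (identities scale mul)"
  unfolding T_ideal_def
proof (intro conjI ballI allI impI)
  show "free_leibniz.subspace (identities scale mul)"
    by (simp add: free_leibniz.subspace_def identities_def subst_simps)
  show "f * g \<in> identities scale mul" "g * f \<in> identities scale mul"
    if "f \<in> identities scale mul" for f g
    using that by (simp_all add: identities_def subst_simps)
  show "\<phi> ` identities scale mul \<subseteq> identities scale mul"
    if "algebra_hom fscale (*) fscale (*) \<phi>" for \<phi>
  proof clarify
    fix f assume "f \<in> identities scale mul"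
    then show "\<phi> f \<in> identities scale mul"
      using subst_compose[OF that, of _ f] by (simp add: identities_def)
  qed
qed

end

lemma T_ideal_Int: "T_ideal I \<Longrightarrow> T_ideal J \<Longrightarrow> T_ideal (I \<inter> J)"
  unfolding T_ideal_def by (simp add: free_leibniz.subspace_inter image_subset_iff)

section \<open>Coordinates, values of words and identities in the three-dimensional algebra\<close>

context L9_algebra
begin

definition coord :: "'a \<Rightarrow> 'a \<Rightarrow> 'k" where
  "coord b v = representation {e1, e2, e3} v b"

lemma coord_linear:
  "coord b (u + v) = coord b u + coord b v" "coord b (scale c v) = c * coord b v" "coord b 0 = 0"
  using basis by (simp_all add: coord_def representation_add representation_scale representation_zero)

lemma coord_sum: "coord b (\<Sum>x\<in>A. f x) = (\<Sum>x\<in>A. coord b (f x))"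
  by (induction A rule: infinite_finite_induct) (simp_all add: coord_linear)

lemma coord_basis: "b \<in> {e1, e2, e3} \<Longrightarrow> coord b' b = (if b = b' then 1 else 0)"
  using basis by (simp add: coord_def representation_basis)

lemma expansion: "scale (coord e1 v) e1 + (scale (coord e2 v) e2 + scale (coord e3 v) e3) = v"
  using sum_representation_eq[of "{e1, e2, e3}" v "{e1, e2, e3}"] basis by (simp add: coord_def)

lemma mul_e1: "mul v e1 = 0" and mul_e2: "mul v e2 = 0"
  and mul_e3: "mul v e3 = scale (\<alpha> * coord e2 v) e1 + scale (coord e1 v) e2"
  by (subst expansion[of v, symmetric],
      simp add: mul_add_left mul_scale_left table mult.commute add.commute)+

definition shift :: "'a \<Rightarrow> 'a" where "shift v = mul v e3"

lemma shift_scale: "shift (scale c v) = scale c (shift v)"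
  by (simp add: shift_def mul_scale_left)

text \<open>Right multiplication by \<open>e1\<close> or \<open>e2\<close> is zero, so only the
  \<open>e3\<close>-coordinate of the right factor matters.\<close>

lemma mul_eq: "mul v w = scale (coord e3 w) (shift v)"
  by (subst expansion[of w, symmetric])
    (simp add: mul_add_right mul_scale_right mul_e1 mul_e2 shift_def)

lemma coord_shift: "coord e1 (shift v) = \<alpha> * coord e2 v" "coord e2 (shift v) = coord e1 v"
  "coord e3 (shift v) = 0"
  using basis by (auto simp: shift_def mul_e3 coord_linear coord_basis)

lemma eqI: "coord e1 v = coord e1 w \<Longrightarrow> coord e2 v = coord e2 w \<Longrightarrow> coord e3 v = coord e3 w \<Longrightarrow> v = w"
  by (metis expansion)

text \<open>The image of \<open>shift\<close> lies in the span of \<open>e1\<close> and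
  \<open>e2\<close>, where the square of \<open>shift\<close> is multiplication by \<alpha>.\<close>

lemma shift_cube: "shift (shift (shift v)) = scale \<alpha> (shift v)"
  by (rule eqI) (simp_all add: coord_shift coord_linear)

lemma funpow_shift_scale: "(shift ^^ n) (scale c v) = scale c ((shift ^^ n) v)"
  by (induction n) (simp_all add: shift_scale)

lemma funpow_shift_odd: "(shift ^^ (2 * n + 1)) v = scale (\<alpha> ^ n) (shift v)"
  by (induction n) (simp_all add: shift_scale shift_cube mult.commute)

text \<open>Odd powers interchange the roles of the two coordinates and even powers do not; this is
  how the parity of a degree is detected.\<close>

lemma coord_funpow_shift:
  "coord e1 ((shift ^^ n) v) = \<alpha> ^ (n div 2) * (if even n then coord e1 v else \<alpha> * coord e2 v)"
  "coord e2 ((shift ^^ n) v) = \<alpha> ^ (n div 2) * (if even n then coord e2 v else coord e1 v)"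
  by (induction n) (auto simp: coord_shift coord_linear elim!: oddE)

lemma subst_mult: "substitution scale mul a (f * g) =
    scale (coord e3 (substitution scale mul a g)) (shift (substitution scale mul a f))"
  by (rule trans[OF subst_mul mul_eq])

lemmas eval_simps = subst_add subst_scale subst_diff subst_zero subst_mult substitution_gen

lemma subst_rmul:
  "substitution scale mul a (rmul h l) =
    scale (\<Prod>j\<in>#mset l. coord e3 (a j)) ((shift ^^ length l) (substitution scale mul a h))"
  by (induction l arbitrary: h)
    (simp_all add: eval_simps funpow_shift_scale funpow_Suc_right mult.commute del: funpow.simps)

lemma subst_rmul_pow:
  "substitution scale mul a (rmul_pow f g n) =
    scale (coord e3 (substitution scale mul a g) ^ n) ((shift ^^ n) (substitution scale mul a f))"
  by (induction n) (simp_all add: rmul_pow_def eval_simps shift_scale)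

text \<open>A product has zero \<open>e3\<close>-coordinate, so it annihilates as a right
  factor.\<close>

lemma X123_identity: "X1 * (X2 * X3) \<in> identities scale mul"
  by (simp add: identities_def eval_simps coord_linear coord_shift)

lemma odd_power_identity:
  assumes "odd q" and "\<And>x :: 'k. x ^ q = x"
  shows "rmul_pow X1 X2 q - fscale (\<alpha> ^ ((q - 1) div 2)) (X1 * X2) \<in> identities scale mul"
proof -
  obtain k where q: "q = 2 * k + 1" using assms(1) by (rule oddE)
  show ?thesis
    using assms(2) funpow_shift_odd[of k]
    by (simp add: identities_def eval_simps subst_rmul_pow q mult.commute)
qed

lemma even_power_identity:
  assumes "0 < q" and "\<And>x :: 'k. x ^ q = x" and "\<alpha> ^ (q - 1) = 1"
  shows "rmul_pow X1 X2 (2 * q - 1) - X1 * X2 \<in> identities scale mul"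
proof -
  have "x ^ (2 * q - 1) = x" for x :: 'k
  proof -
    have "2 * q - 1 = q + (q - 1)" using assms(1) by simp
    then have "x ^ (2 * q - 1) = x ^ q * x ^ (q - 1)" by (simp only: power_add)
    also have "\<dots> = x ^ Suc (q - 1)" by (simp add: assms(2))
    finally show ?thesis using assms(1,2) by simp
  qed
  moreover have "2 * q - 1 = 2 * (q - 1) + 1" using assms(1) by simp
  then have "(shift ^^ (2 * q - 1)) v = shift v" for v
    using funpow_shift_odd[of "q - 1" v] assms(3) by simp
  ultimately show ?thesis
    by (simp add: identities_def eval_simps subst_rmul_pow)
qed

text \<open>Both terms apply \<open>shift\<close> exactly \<open>q + 1\<close> times, and their
  scalars agree by Fermat.\<close>

lemma exchange_identity:
  assumes "\<And>x :: 'k. x ^ q = x"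
  shows "rmul_pow X1 X2 q * X3 - rmul_pow (X1 * X2) X3 q \<in> identities scale mul"
  by (simp add: identities_def eval_simps subst_rmul_pow assms funpow_shift_scale shift_scale
      funpow_swap1[of shift] mult.commute)

text \<open>Modulo \<open>J\<close> an identity is a combination of words, one for each first letter
  and class of monomials. This combination is again an identity, and independence of characters
  makes its coefficients vanish.\<close>

lemma identities_subset:
  assumes \<alpha>: "\<alpha> \<noteq> 0" and J: "left_normed_T_ideal J" and sub: "J \<subseteq> identities scale mul"
    and sim: "\<And>m m'. \<lbrakk>\<And>c :: nat \<Rightarrow> 'k. (\<Prod>j\<in>#m. c j) = (\<Prod>j\<in>#m'. c j);
      even (size m) \<longleftrightarrow> even (size m')\<rbrakk> \<Longrightarrow> left_normed_T_ideal.sim J m m'"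
  shows "identities scale mul \<subseteq> J"
proof
  interpret J: left_normed_T_ideal J by fact
  fix f assume f: "f \<in> identities scale mul"
  define \<chi> where "\<chi> m c = (\<Prod>j\<in>#m. c j)" for m :: "nat multiset" and c :: "nat \<Rightarrow> 'k"
  define cls where "cls m = (\<chi> m, even (size m))" for m
  \<comment> \<open>\<open>s\<close> chooses one monomial in each class of equal function and
    parity.\<close>
  define s where "s = inv cls \<circ> cls"
  have cls_s: "cls (s m) = cls m" for m
    by (simp add: s_def f_inv_into_f)
  have inj: "inj_on cls (range s)"
    by (auto simp: inj_on_def cls_s s_def f_inv_into_f)
  define w where "w = (\<lambda>(i, m). rmul (gen i :: 'k free_leibniz) (sorted_list_of_multiset m))"
  have "J.sim m (s m)" for m
  proof (rule sim)
    show "(\<Prod>j\<in>#m. c j) = (\<Prod>j\<in>#s m. c j)" for c :: "nat \<Rightarrow> 'k"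
      using cls_s[of m] by (simp add: cls_def \<chi>_def fun_eq_iff)
    show "even (size m) \<longleftrightarrow> even (size (s m))"
      using cls_s[of m] by (simp add: cls_def)
  qed
  then have "f \<in> free_leibniz.span (w ` (UNIV \<times> range s) \<union> J)"
    unfolding w_def by (rule J.span_representatives)
  then obtain g j where fgj: "f = g + j" and g: "g \<in> free_leibniz.span (w ` (UNIV \<times> range s))"
    and j: "j \<in> J"
    using free_leibniz.span_eq_iff[THEN iffD2, OF J.subspace] by (auto simp: free_leibniz.span_Un)
  obtain t k where t: "finite t" "t \<subseteq> w ` (UNIV \<times> range s)" "g = (\<Sum>x\<in>t. fscale (k x) x)"
    using g by (auto simp: free_leibniz.span_explicit)
  \<comment> \<open>Injectivity of \<open>w\<close> as a whole is not at hand, so one index pair is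
    chosen for each word that occurs.\<close>
  obtain A where A: "A \<subseteq> UNIV \<times> range s" "inj_on w A" "t = w ` A"
    using t(2) by (auto simp: subset_image_inj)
  have finA: "finite A" using t(1) A by (simp add: finite_image_iff)
  have g_sum: "g = (\<Sum>x\<in>A. fscale (k (w x)) (w x))"
    by (simp add: t(3) A(3) sum.reindex[OF A(2)])
  have "g \<in> identities scale mul"
    using f j sub unfolding fgj identities_def by (auto simp: subst_simps subset_iff)
  then have g0: "substitution scale mul a g = 0" for a by (simp add: identities_def)
  have "k (w (i, m)) = 0" if im: "(i, m) \<in> A" for i m
  proof -
    define P where "P = {m'. (i, m') \<in> A \<and> (even (size m') \<longleftrightarrow> even (size m))}"
    have finP: "finite P"
      by (rule finite_subset[OF _ finite_imageI[OF finA, of snd]]) (force simp: P_def)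
    have "k (w (i, m)) * \<alpha> ^ (size m div 2) = 0"
    \<comment> \<open>The weight \<open>\<alpha> ^ (size m' div 2)\<close> is the scalar that the
      powers of \<open>shift\<close> contribute.\<close>
    proof (rule characters_independent[where A = P and \<chi> = \<chi> and op = "\<lambda>c d j. c j * d j"
          and k = "\<lambda>m'. k (w (i, m')) * \<alpha> ^ (size m' div 2)"])
      show "inj_on \<chi> P"
      proof (rule inj_onI)
        fix m1 m2 assume m: "m1 \<in> P" "m2 \<in> P" and eq: "\<chi> m1 = \<chi> m2"
        then have "cls m1 = cls m2" by (simp add: P_def cls_def)
        moreover have "m1 \<in> range s" "m2 \<in> range s" using m A(1) by (auto simp: P_def)
        ultimately show "m1 = m2" by (rule inj_onD[OF inj])
      qed
      show "\<exists>x. \<chi> m' x \<noteq> 0" for m' by (rule exI[of _ "\<lambda>_. 1"]) (simp add: \<chi>_def)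
      show "(\<Sum>m'\<in>P. k (w (i, m')) * \<alpha> ^ (size m' div 2) * \<chi> m' c) = 0" for c
      proof -
        \<comment> \<open>Only \<open>a i\<close> has an \<open>e1\<close>-part, which kills words
          with another first letter. Its image under \<open>shift\<close> powers lies along
          \<open>e1\<close> or \<open>e2\<close> according to parity, so the coordinate
          \<open>b\<close> kills the other parity.\<close>
        define a where "a l = (if l = i then e1 else 0) + scale (c l) e3" for l
        define b where "b = (if even (size m) then e1 else e2)"
        have dist: "e1 \<noteq> e2" "e1 \<noteq> e3" "e2 \<noteq> e3" using basis(1) by auto
        have a3: "coord e3 (a l) = c l" for l
          using dist by (simp add: a_def coord_linear coord_basis)
        have a12: "coord e1 (a l) = (if l = i then 1 else 0)" "coord e2 (a l) = 0" for l
          using dist by (auto simp: a_def coord_linear coord_basis)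
        have w_val: "coord b (substitution scale mul a (w (i', m'))) =
          (if i' = i \<and> (even (size m') \<longleftrightarrow> even (size m))
           then \<alpha> ^ (size m' div 2) * \<chi> m' c else 0)"
          for i' m'
        proof -
          have "length (sorted_list_of_multiset m') = size m'"
            by (metis mset_sorted_list_of_multiset size_mset)
          then show ?thesis
            by (simp add: w_def subst_rmul substitution_gen a3 coord_linear b_def coord_funpow_shift a12
                \<chi>_def mult.commute)
        qed
        have "0 = coord b (substitution scale mul a g)" by (simp add: g0 coord_linear)
        also have "\<dots> = (\<Sum>x\<in>A. k (w x) * coord b (substitution scale mul a (w x)))"
          by (simp add: g_sum subst_sum subst_simps coord_sum coord_linear)
        also have "\<dots> = (\<Sum>x\<in>Pair i ` P. k (w x) * coord b (substitution scale mul a (w x)))"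
          by (rule sum.mono_neutral_right) (use finA in \<open>auto simp: P_def w_val split: if_splits\<close>)
        also have "\<dots> = (\<Sum>m'\<in>P. k (w (i, m')) * \<alpha> ^ (size m' div 2) * \<chi> m' c)"
          by (subst sum.reindex) (auto simp: inj_on_def w_val P_def intro!: sum.cong)
        finally show ?thesis by simp
      qed
    qed (use im finP in \<open>auto simp: P_def \<chi>_def prod_mset.distrib\<close>)
    with \<alpha> show ?thesis by simp
  qed
  then have "g = 0" unfolding g_sum by (intro sum.neutral) auto
  with fgj j show "f \<in> J" by simp
qed

text \<open>Intersecting \<open>J\<close> with the T-ideal of identities gives the inclusion that
  \<open>identities_subset\<close> demands and still contains \<open>S\<close>.\<close>

lemma generates_identitiesI:
  assumes \<alpha>: "\<alpha> \<noteq> 0" and X: "X1 * (X2 * X3) \<in> S" and S: "S \<subseteq> identities scale mul"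
    and sim: "\<And>J m m'. \<lbrakk>left_normed_T_ideal J; S \<subseteq> J;
      \<And>c :: nat \<Rightarrow> 'k. (\<Prod>j\<in>#m. c j) = (\<Prod>j\<in>#m'. c j);
      even (size m) \<longleftrightarrow> even (size m')\<rbrakk> \<Longrightarrow> left_normed_T_ideal.sim J m m'"
  shows "generates_T_ideal S (identities scale mul)"
  unfolding generates_T_ideal_def
proof (intro conjI allI impI T_ideal_identities S)
  fix J assume J: "T_ideal J \<and> S \<subseteq> J"
  have N: "left_normed_T_ideal (J \<inter> identities scale mul)"
    by (rule left_normed_T_ideal.intro)
      (use J X S in \<open>auto intro: T_ideal_Int T_ideal_identities\<close>)
  have "identities scale mul \<subseteq> J \<inter> identities scale mul"
    by (rule identities_subset[OF \<alpha> N]) (use sim[OF N] J S in auto)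
  then show "identities scale mul \<subseteq> J" by blast
qed

end

theorem theorem3p10:
  fixes scale :: "'k::field \<Rightarrow> 'a::ab_group_add \<Rightarrow> 'a"
    and mul :: "'a \<Rightarrow> 'a \<Rightarrow> 'a"
    and \<alpha> :: 'k and e1 e2 e3 :: 'a
  assumes "L9_algebra scale mul \<alpha> e1 e2 e3"
    and "\<alpha> \<noteq> 0"
  shows
    "(infinite (UNIV :: 'k set) \<longrightarrow>
        generates_T_ideal {X1 * (X2 * X3)} (identities scale mul)) \<and>
     (\<forall>q. finite (UNIV :: 'k set) \<and> card (UNIV :: 'k set) = q \<longrightarrow>
        (odd q \<longrightarrow>
           generates_T_ideal
             {X1 * (X2 * X3),
              rmul_pow X1 X2 q - fscale (\<alpha> ^ ((q - 1) div 2)) (X1 * X2)}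
             (identities scale mul)) \<and>
        (even q \<longrightarrow>
           generates_T_ideal
             {X1 * (X2 * X3),
              rmul_pow X1 X2 (2 * q - 1) - X1 * X2,
              rmul_pow X1 X2 q * X3 - rmul_pow (X1 * X2) X3 q}
             (identities scale mul)))"
proof (intro conjI allI impI)
  interpret L9_algebra scale mul \<alpha> e1 e2 e3 by fact
  show "generates_T_ideal {X1 * (X2 * X3)} (identities scale mul)"
    if inf: "infinite (UNIV :: 'k set)"
  proof (rule generates_identitiesI[OF assms(2)])
    fix J and m m' :: "nat multiset"
    assume J: "left_normed_T_ideal (J :: 'k free_leibniz set)"
      and eq: "\<And>c :: nat \<Rightarrow> 'k. (\<Prod>j\<in>#m. c j) = (\<Prod>j\<in>#m'. c j)"
    \<comment> \<open>Over an infinite field the bound on exponents is vacuous.\<close>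
    have "m = m'" using eq by (rule reduced_multiset_eqI) (use inf in auto)
    then show "left_normed_T_ideal.sim J m m'"
      by (simp add: left_normed_T_ideal.sim_refl[OF J])
  qed (use X123_identity in simp_all)
  fix q assume "finite (UNIV :: 'k set) \<and> card (UNIV :: 'k set) = q"
  then have fin: "finite (UNIV :: 'k set)" and card: "q = card (UNIV :: 'k set)" by auto
  have Fermat: "x ^ q = x" for x :: 'k
    unfolding card using fin by (rule finite_field_power_card)
  have "card {0, 1 :: 'k} \<le> q" unfolding card by (rule card_mono) (use fin in auto)
  then have q2: "2 \<le> q" by simp
  have \<alpha>1: "\<alpha> ^ (q - 1) = 1"
    unfolding card using fin assms(2) by (rule finite_field_power_card_minus_one)
  show "generates_T_ideal
      {X1 * (X2 * X3), rmul_pow X1 X2 q - fscale (\<alpha> ^ ((q - 1) div 2)) (X1 * X2)}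
      (identities scale mul)" if "odd q"
  proof (rule generates_identitiesI[OF assms(2)])
    fix J and m m' :: "nat multiset"
    assume "left_normed_T_ideal (J :: 'k free_leibniz set)"
      and S: "{X1 * (X2 * X3), rmul_pow X1 X2 q - fscale (\<alpha> ^ ((q - 1) div 2)) (X1 * X2)} \<subseteq> J"
      and eq: "\<And>c :: nat \<Rightarrow> 'k. (\<Prod>j\<in>#m. c j) = (\<Prod>j\<in>#m'. c j)"
    then interpret J: left_normed_T_ideal J by simp
    have power: "J.sim (replicate_mset q j) {#j#}" for j
    proof -
      \<comment> \<open>Substitute \<open>h\<close> for \<open>X1\<close> and \<open>gen j\<close>
        for \<open>X2\<close>; the resulting scalar is nonzero because \<alpha> is.\<close>
      have "rmul h (replicate q j) - fscale (\<alpha> ^ ((q - 1) div 2)) (rmul h [j]) \<in> J" for h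
        using J.subst_mem[of _ "\<lambda>i. if i = 0 then h else gen j"] S
        by (fastforce simp: free_leibniz.subst_simps rmul_replicate
            hom_rmul_pow[OF free_leibniz.algebra_hom_substitution])
      from J.simI[OF _ this] assms(2) show ?thesis by simp
    qed
    obtain r where r: "\<forall>j. count r j < q" "J.sim m r"
      "\<forall>c :: nat \<Rightarrow> 'k. (\<Prod>j\<in>#m. c j) = (\<Prod>j\<in>#r. c j)"
      using J.sim_reduced[OF q2 Fermat power] by blast
    obtain r' where r': "\<forall>j. count r' j < q" "J.sim m' r'"
      "\<forall>c :: nat \<Rightarrow> 'k. (\<Prod>j\<in>#m'. c j) = (\<Prod>j\<in>#r'. c j)"
      using J.sim_reduced[OF q2 Fermat power] by blast
    \<comment> \<open>Both are reduced with the same function, which determines all exponents below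
      \<open>q\<close>.\<close>
    have "r = r'"
    proof (rule reduced_multiset_eqI)
      show "(\<Prod>j\<in>#r. c j) = (\<Prod>j\<in>#r'. c j)" for c :: "nat \<Rightarrow> 'k"
        using eq[of c] r(3) r'(3) by simp
    qed (use r(1) r'(1) card in auto)
    then show "J.sim m m'" using r(2) r'(2) J.sim_sym J.sim_trans by blast
  qed (use X123_identity odd_power_identity[OF that Fermat] in simp_all)
  show "generates_T_ideal {X1 * (X2 * X3), rmul_pow X1 X2 (2 * q - 1) - X1 * X2,
      rmul_pow X1 X2 q * X3 - rmul_pow (X1 * X2) X3 q} (identities scale mul)" if "even q"
  proof (rule generates_identitiesI[OF assms(2)])
    fix J and m m' :: "nat multiset"
    assume "left_normed_T_ideal (J :: 'k free_leibniz set)"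
      and S: "{X1 * (X2 * X3), rmul_pow X1 X2 (2 * q - 1) - X1 * X2,
        rmul_pow X1 X2 q * X3 - rmul_pow (X1 * X2) X3 q} \<subseteq> J"
      and eq: "\<And>c :: nat \<Rightarrow> 'k. (\<Prod>j\<in>#m. c j) = (\<Prod>j\<in>#m'. c j)"
      and parity: "even (size m) \<longleftrightarrow> even (size m')"
    then interpret J: left_normed_T_ideal J by simp
    have exchange: "J.sim (replicate_mset q i + {#j#}) (replicate_mset q j + {#i#})" for i j
    proof -
      let ?a = "\<lambda>h k. if k = 0 then h else if k = (1 :: nat) then gen i else gen j"
      \<comment> \<open>This is the third generator under the substitution
        \<open>?a h\<close>.\<close>
      have "rmul h (replicate q i @ [j]) - fscale 1 (rmul h (i # replicate q j)) \<in> J" for h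
        using J.subst_mem[of "rmul_pow X1 X2 q * X3 - rmul_pow (X1 * X2) X3 q" "?a h"] S
        by (simp add: free_leibniz.subst_simps rmul_replicate
            hom_rmul_pow[OF free_leibniz.algebra_hom_substitution])
      from J.simI[OF _ this] show ?thesis by simp
    qed
    have power: "J.sim (replicate_mset (2 * q - 1) j) {#j#}" for j
    proof -
      have "rmul h (replicate (2 * q - 1) j) - fscale 1 (rmul h [j]) \<in> J" for h
        using J.subst_mem[of "rmul_pow X1 X2 (2 * q - 1) - X1 * X2" 
            "\<lambda>i. if i = 0 then h else gen j"] S
        by (simp add: free_leibniz.subst_simps rmul_replicate
            hom_rmul_pow[OF free_leibniz.algebra_hom_substitution])
      from J.simI[OF _ this] show ?thesis by simp
    qed
    show "J.sim m m'"
      by (rule J.sim_if_same_function_and_parity[OF that card q2 Fermat exchange power eq parity])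
  next
    have "0 < q" using q2 by simp
    then show "{X1 * (X2 * X3), rmul_pow X1 X2 (2 * q - 1) - X1 * X2,
        rmul_pow X1 X2 q * X3 - rmul_pow (X1 * X2) X3 q} \<subseteq> identities scale mul"
      by (intro insert_subsetI empty_subsetI X123_identity exchange_identity Fermat
          even_power_identity[OF _ Fermat \<alpha>1])
  qed (rule insertI1)
qed

end
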